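(* Let $L$ be the step 2 free-nilpotent Lie algebra with $k=3$ generators, with the coordinates $h_1,h_2,h_3,h_{12},h_{13},h_{23}$ on $L^*$ and the matrix $M=(h_{ij})\in\mathfrak{so}(3)$ described in the context. Then the symplectic foliation on $L^*$ (its decomposition into symplectic leaves, i.e. coadjoint orbits) consists of the following leaves: (1) $2$-dimensional leaves $$h_{ij}=\mathrm{const}\ (1\le i<j\le 3),\qquad M\neq 0,\qquad I_a(h)=\mathrm{const},$$ where $\ker M=\mathbb{R}a$ and $I_a(h)=\sum_{i=1}^3 a_ih_i$; (2) $0$-dimensional leaves $$h_{ij}=0\ (1\le i<j\le 3),\qquad (h_1,h_2,h_3)=\mathrm{const}.$$
   Context: $L=L^{(1)}\oplus L^{(2)}$ is the real 6-dimensional step 2 free-nilpotent Lie algebra with 3 generators: $L^{(1)}$ has basis $X_1,X_2,X_3$, $L^{(2)}$ has basis $X_{12},X_{13},X_{23}$, with $[X_i,X_j]=X_{ij}$ for $1\le i<j\le 3$ and all $X_{ij}$ central. On $L^*$ define the linear coordinates $h_i(\lambda)=\langle\lambda,X_i\rangle$, $h_{ij}(\lambda)=\langle\lambda,X_{ij}\rangle$. The Lie–Poisson bracket on $L^*$ is determined by $\{h_i,h_j\}=h_{ij}$ and $\{h_{ij},h_l\}=\{h_{ij},h_{lm}\}=0$. The symplectic leaves of this Poisson structure are the orbits of the coadjoint action on $L^*$ of the connected simply connected Lie group $G$ with Lie algebra $L$. The skew-symmetric matrix $M$ at a point of $L^*$ is $$M=\begin{pmatrix}0&h_{12}&h_{13}\\-h_{12}&0&h_{23}\\-h_{13}&-h_{23}&0\end{pmatrix},$$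 which has one-dimensional kernel whenever $M\neq0$. *)

theory Defs
  imports "HOL-Analysis.Analysis"
begin

text \<open>The pair \<open>(x, u)\<close> stands for
  \<open>x\<^sub>1 (X 1) + x\<^sub>2 (X 2) + x\<^sub>3 (X 3) + u\<^sub>1 X12 + u\<^sub>2 X13 + u\<^sub>3 X23\<close>; the factors are the layers
  \<open>L\<^sup>(\<^sup>1\<^sup>)\<close> and \<open>L\<^sup>(\<^sup>2\<^sup>)\<close>.\<close>

type_synonym lie = "(real^3) \<times> (real^3)"

type_synonym lie_dual = "lie \<Rightarrow>\<^sub>L real"

definition X :: "3 \<Rightarrow> lie" where "X i = (axis i 1, 0)"
definition X12 :: lie where "X12 = (0, axis 1 1)"
definition X13 :: lie where "X13 = (0, axis 2 1)"
definition X23 :: lie where "X23 = (0, axis 3 1)"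

definition lie_bracket :: "lie \<Rightarrow> lie \<Rightarrow> lie" where
  "lie_bracket p q = (let x = fst p; y = fst q in
     (x$1 * y$2 - x$2 * y$1) *\<^sub>R X12
   + (x$1 * y$3 - x$3 * y$1) *\<^sub>R X13
   + (x$2 * y$3 - x$3 * y$2) *\<^sub>R X23)"

lemma lie_bracket_basis:
  "lie_bracket (X 1) (X 2) = X12" "lie_bracket (X 1) (X 3) = X13" "lie_bracket (X 2) (X 3) = X23"
  by (simp_all add: lie_bracket_def X_def axis_def)

lemma lie_bracket_central:
  "lie_bracket X12 p = 0" "lie_bracket X13 p = 0" "lie_bracket X23 p = 0"
  by (simp_all add: lie_bracket_def X12_def X13_def X23_def zero_prod_def)

lemma lie_bracket_bilinear: "bilinear lie_bracket"
  unfolding bilinear_def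
  by (auto intro!: linearI simp: lie_bracket_def Let_def algebra_simps)

lemma lie_bracket_self: "lie_bracket p p = 0"
  by (simp add: lie_bracket_def)

lemma fst_lie_bracket: "fst (lie_bracket p q) = 0"
  by (simp add: lie_bracket_def Let_def X12_def X13_def X23_def)

lemma lie_bracket_step_2: "lie_bracket (lie_bracket p q) r = 0" "lie_bracket r (lie_bracket p q) = 0"
  by (simp_all add: lie_bracket_def[of "lie_bracket p q" r] lie_bracket_def[of r "lie_bracket p q"]
      fst_lie_bracket)

text \<open>In step 2 the Baker-Campbell-Hausdorff series stops after the first bracket, and the
  product it defines on \<open>L\<close> is that of the connected simply connected Lie group \<open>G\<close> with Lie
  algebra \<open>L\<close>, written in exponential coordinates. The unit is \<open>0\<close>, and the tangent space at \<open>0\<close>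
  is \<open>L\<close>.\<close>

definition group_mult :: "lie \<Rightarrow> lie \<Rightarrow> lie" where
  "group_mult g k = g + k + (1/2) *\<^sub>R lie_bracket g k"

definition group_inv :: "lie \<Rightarrow> lie" where
  "group_inv g = - g"

lemma group_mult_assoc: "group_mult (group_mult a b) c = group_mult a (group_mult b c)"
proof -
  note bl = bilinear_ladd[OF lie_bracket_bilinear] bilinear_radd[OF lie_bracket_bilinear]
    bilinear_lmul[OF lie_bracket_bilinear] bilinear_rmul[OF lie_bracket_bilinear]
  show ?thesis
    by (simp add: group_mult_def bl lie_bracket_step_2 algebra_simps)
qed

lemma group_mult_unit: "group_mult 0 g = g" "group_mult g 0 = g"
  by (simp_all add: group_mult_def lie_bracket_def)

lemma group_mult_inv: "group_mult (group_inv g) g = 0" "group_mult g (group_inv g) = 0"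
  by (simp_all add: group_mult_def group_inv_def lie_bracket_def Let_def algebra_simps)

definition Ad :: "lie \<Rightarrow> lie \<Rightarrow> lie" where
  "Ad g = frechet_derivative (\<lambda>k. group_mult (group_mult g k) (group_inv g)) (at 0)"

definition coadjoint :: "lie \<Rightarrow> lie_dual \<Rightarrow> lie_dual" where
  "coadjoint g \<xi> = Blinfun (\<lambda>x. blinfun_apply \<xi> (Ad (group_inv g) x))"

definition coadjoint_orbit :: "lie_dual \<Rightarrow> lie_dual set" where
  "coadjoint_orbit \<xi> = range (\<lambda>g. coadjoint g \<xi>)"

definition h :: "3 \<Rightarrow> lie_dual \<Rightarrow> real" where "h i \<xi> = blinfun_apply \<xi> (X i)"
definition h12 :: "lie_dual \<Rightarrow> real" where "h12 \<xi> = blinfun_apply \<xi> X12"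
definition h13 :: "lie_dual \<Rightarrow> real" where "h13 \<xi> = blinfun_apply \<xi> X13"
definition h23 :: "lie_dual \<Rightarrow> real" where "h23 \<xi> = blinfun_apply \<xi> X23"

text \<open>The matrix \<open>M\<close> at the point \<open>\<xi>\<close> is \<open>skew (h12 \<xi>) (h13 \<xi>) (h23 \<xi>)\<close>.\<close>

definition skew :: "real \<Rightarrow> real \<Rightarrow> real \<Rightarrow> real^3^3" where
  "skew p q r = vector [vector [0, p, q], vector [- p, 0, r], vector [- q, - r, 0]]"

definition I :: "real^3 \<Rightarrow> lie_dual \<Rightarrow> real" where
  "I a \<xi> = (\<Sum>i\<in>UNIV. a $ i * h i \<xi>)"

text \<open>On an open subset \<open>U\<close> of a finite-dimensional space this is the usual class \<open>C\<^sup>k\<close>.\<close>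

primrec Ck_on :: "nat \<Rightarrow> 'a::real_normed_vector set \<Rightarrow> ('a \<Rightarrow> 'b::real_normed_vector) \<Rightarrow> bool" where
  "Ck_on 0 U f \<longleftrightarrow> continuous_on U f"
| "Ck_on (Suc k) U f \<longleftrightarrow> (\<forall>x\<in>U. f differentiable (at x)) \<and>
     (\<forall>v. Ck_on k U (\<lambda>x. frechet_derivative f (at x) v))"

definition smooth_on :: "'a::real_normed_vector set \<Rightarrow> ('a \<Rightarrow> 'b::real_normed_vector) \<Rightarrow> bool" where
  "smooth_on U f \<longleftrightarrow> (\<forall>k. Ck_on k U f)"

text \<open>The differential at \<open>\<xi>\<close> of a function on \<open>L\<^sup>*\<close> lies in \<open>L\<^sup>*\<^sup>*\<close>, which is identified with \<open>L\<close>.\<close>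

definition differential :: "(lie_dual \<Rightarrow> real) \<Rightarrow> lie_dual \<Rightarrow> lie" where
  "differential f \<xi> = (THE x. \<forall>\<eta>. frechet_derivative f (at \<xi>) \<eta> = blinfun_apply \<eta> x)"

definition poisson :: "(lie_dual \<Rightarrow> real) \<Rightarrow> (lie_dual \<Rightarrow> real) \<Rightarrow> lie_dual \<Rightarrow> real" where
  "poisson f g \<xi> = blinfun_apply \<xi> (lie_bracket (differential f \<xi>) (differential g \<xi>))"

lemma blinfun_separates:
  fixes x y :: lie
  assumes "\<And>\<eta> :: lie_dual. blinfun_apply \<eta> x = blinfun_apply \<eta> y"
  shows "x = y"
proof -
  have "inner x (x - y) = inner y (x - y)"
    using assms[of "blinfun_inner_left (x - y)"] by (simp add: inner_commute)
  then have "inner (x - y) (x - y) = 0" by (simp add: inner_diff_left)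
  then show ?thesis by simp
qed

lemma differential_apply: "differential (\<lambda>\<eta>. blinfun_apply \<eta> x) \<xi> = x"
proof -
  have "frechet_derivative (\<lambda>\<eta>::lie_dual. blinfun_apply \<eta> x) (at \<xi>) = (\<lambda>\<eta>. blinfun_apply \<eta> x)"
    by (rule frechet_derivative_at[symmetric]) (auto intro!: derivative_eq_intros)
  then show ?thesis
    unfolding differential_def by (intro the_equality) (auto intro: blinfun_separates)
qed

lemma poisson_coordinates:
  "poisson (h 1) (h 2) = h12" "poisson (h 1) (h 3) = h13" "poisson (h 2) (h 3) = h23"
  by (auto simp: fun_eq_iff poisson_def h_def[abs_def] h12_def h13_def h23_def differential_apply
      lie_bracket_basis)

lemma poisson_central:
  "poisson h12 (\<lambda>\<eta>. blinfun_apply \<eta> x) \<xi> = 0" "poisson h13 (\<lambda>\<eta>. blinfun_apply \<eta> x) \<xi> = 0"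
  "poisson h23 (\<lambda>\<eta>. blinfun_apply \<eta> x) \<xi> = 0"
  by (simp_all add: poisson_def h12_def[abs_def] h13_def[abs_def] h23_def[abs_def]
      differential_apply lie_bracket_central)

text \<open>Here \<open>\<gamma>\<close> is an integral curve over the time interval \<open>[0,1]\<close> of the Hamiltonian vector field
  \<open>{H, \<cdot>}\<close>, a vector field being a derivation acting on smooth functions.\<close>

definition hamiltonian_curve :: "(lie_dual \<Rightarrow> real) \<Rightarrow> (real \<Rightarrow> lie_dual) \<Rightarrow> bool" where
  "hamiltonian_curve H \<gamma> \<longleftrightarrow> (\<forall>f :: lie_dual \<Rightarrow> real. smooth_on UNIV f \<longrightarrow>
     (\<forall>t\<in>{0..1}. ((\<lambda>s. f (\<gamma> s)) has_real_derivative poisson H f (\<gamma> t)) (at t within {0..1})))"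

definition hamiltonian_step :: "lie_dual \<Rightarrow> lie_dual \<Rightarrow> bool" where
  "hamiltonian_step \<xi> \<eta> \<longleftrightarrow>
     (\<exists>H \<gamma>. smooth_on UNIV H \<and> hamiltonian_curve H \<gamma> \<and> \<gamma> 0 = \<xi> \<and> \<gamma> 1 = \<eta>)"

text \<open>The leaf through \<open>\<xi>\<close> consists of the points joined to \<open>\<xi>\<close> by finitely many successive
  trajectories of Hamiltonian vector fields.\<close>

definition symplectic_leaf :: "lie_dual \<Rightarrow> lie_dual set" where
  "symplectic_leaf \<xi> = {\<eta>. hamiltonian_step\<^sup>*\<^sup>* \<xi> \<eta>}"

definition symplectic_foliation :: "lie_dual set set" where
  "symplectic_foliation = range symplectic_leaf"

text \<open>Local straightening by a diffeomorphism \<open>\<phi> : U \<rightarrow> V\<close> with inverse \<open>\<psi>\<close>. The ambient space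
  is meant to be finite-dimensional; \<open>dim\<close> and \<open>subspace\<close> are the linear-algebra notions.\<close>

definition smooth_submanifold :: "nat \<Rightarrow> 'a::real_normed_vector set \<Rightarrow> bool" where
  "smooth_submanifold d S \<longleftrightarrow> (\<forall>p\<in>S. \<exists>U V W. \<exists>\<phi> \<psi> :: 'a \<Rightarrow> 'a.
     open U \<and> p \<in> U \<and> open V \<and> smooth_on U \<phi> \<and> smooth_on V \<psi> \<and>
     \<phi> ` U = V \<and> \<psi> ` V = U \<and> (\<forall>x\<in>U. \<psi> (\<phi> x) = x) \<and> (\<forall>y\<in>V. \<phi> (\<psi> y) = y) \<and>
     subspace W \<and> dim W = d \<and> \<phi> ` (U \<inter> S) = V \<inter> W)"

definition kernel :: "real^3^3 \<Rightarrow> (real^3) set" where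
  "kernel A = {v. A *v v = 0}"

definition leaves_M_nonzero :: "lie_dual set set" where
  "leaves_M_nonzero = {S. \<exists>p q r c a. skew p q r \<noteq> 0 \<and> kernel (skew p q r) = span {a} \<and>
     S = {\<xi>. h12 \<xi> = p \<and> h13 \<xi> = q \<and> h23 \<xi> = r \<and> I a \<xi> = c}}"

definition leaves_M_zero :: "lie_dual set set" where
  "leaves_M_zero = {S. \<exists>c1 c2 c3.
     S = {\<xi>. h12 \<xi> = 0 \<and> h13 \<xi> = 0 \<and> h23 \<xi> = 0 \<and> h 1 \<xi> = c1 \<and> h 2 \<xi> = c2 \<and> h 3 \<xi> = c3}}"

end

theory Submission
  imports Defs
begin

text \<open>Write \<open>h\<close> for the vector \<open>(h\<^sub>1, h\<^sub>2, h\<^sub>3)\<close>. The element of \<open>G\<close> with first layer \<open>x\<close> acts on \<open>L\<^sup>*\<close> by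
  \<open>h \<mapsto> h + M x\<close> and fixes every \<open>h\<^sub>i\<^sub>j\<close>. Since \<open>M\<close> is skew-symmetric, its image is the orthogonal
  complement of its kernel, so the orbits are the common level sets of the \<open>h\<^sub>i\<^sub>j\<close> and of all \<open>I\<^sub>a\<close>
  with \<open>a \<in> ker M\<close>. These functions are Casimirs, hence constant on Hamiltonian trajectories;
  conversely the flow of a linear Hamiltonian moves straight to any prescribed point of the orbit.\<close>

subsection \<open>Coordinates on the dual\<close>

definition h_vec :: "lie_dual \<Rightarrow> real^3" where "h_vec \<xi> = (\<chi> i. h i \<xi>)"

definition M :: "lie_dual \<Rightarrow> real^3^3" where "M \<xi> = skew (h12 \<xi>) (h13 \<xi>) (h23 \<xi>)"

text \<open>Supplies points with prescribed coordinates: the basis of \<open>L\<close> is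
  orthonormal for the product inner product, which identifies \<open>L\<close> with its
  dual.\<close>

definition of_coords :: "real^3 \<Rightarrow> real^3 \<Rightarrow> lie_dual" where
  "of_coords v u = blinfun_inner_left (v, u)"

lemma of_coords_coordinates [simp]:
  "h_vec (of_coords v u) = v" "h i (of_coords v u) = v $ i"
  "h12 (of_coords v u) = u $ 1" "h13 (of_coords v u) = u $ 2" "h23 (of_coords v u) = u $ 3"
  by (simp_all add: of_coords_def h_vec_def h_def h12_def h13_def h23_def
      X_def X12_def X13_def X23_def inner_axis vec_eq_iff inner_commute)

lemma linear_of_coords: "linear (\<lambda>v. of_coords v 0)"
  by (intro linearI blinfun_eqI) (auto simp: of_coords_def blinfun.bilinear_simps inner_add_right)

lemma blinfun_apply_coords:
  "blinfun_apply \<xi> y = h_vec \<xi> \<bullet> fst y + h12 \<xi> * snd y $ 1 + h13 \<xi> * snd y $ 2 + h23 \<xi> * snd y $ 3"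
proof -
  have "y = (fst y $ 1) *\<^sub>R X 1 + (fst y $ 2) *\<^sub>R X 2 + (fst y $ 3) *\<^sub>R X 3
      + (snd y $ 1) *\<^sub>R X12 + (snd y $ 2) *\<^sub>R X13 + (snd y $ 3) *\<^sub>R X23" (is "_ = ?s")
    by (simp add: prod_eq_iff vec_eq_iff forall_3 X_def X12_def X13_def X23_def axis_def)
  then have "blinfun_apply \<xi> y = blinfun_apply \<xi> ?s" by simp
  also have "\<dots> = h_vec \<xi> \<bullet> fst y + h12 \<xi> * snd y $ 1 + h13 \<xi> * snd y $ 2 + h23 \<xi> * snd y $ 3"
    by (simp add: blinfun.bilinear_simps h_vec_def h_def h12_def h13_def h23_def
        inner_vec_def sum_3 algebra_simps)
  finally show ?thesis .
qed

lemma lie_dual_eqI: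
  assumes "h_vec \<xi> = h_vec \<eta>" "h12 \<xi> = h12 \<eta>" "h13 \<xi> = h13 \<eta>" "h23 \<xi> = h23 \<eta>"
  shows "\<xi> = \<eta>"
  by (intro blinfun_eqI) (simp add: blinfun_apply_coords assms)

lemma I_eq_inner: "I a \<xi> = a \<bullet> h_vec \<xi>"
  by (simp add: I_def h_vec_def inner_vec_def)

text \<open>The Kirillov form at \<open>\<xi>\<close>. The second layer is central, so
  \<open>M \<xi>\<close> carries all of it.\<close>

lemma bracket_pairing: "blinfun_apply \<xi> (lie_bracket x y) = fst x \<bullet> (M \<xi> *v fst y)"
  by (simp add: lie_bracket_def Let_def M_def skew_def matrix_vector_mult_def
      inner_vec_def sum_3 vector_3 blinfun.bilinear_simps h12_def h13_def h23_def algebra_simps)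

lemma coords_diff:
  "h_vec (\<xi> - \<eta>) = h_vec \<xi> - h_vec \<eta>" "h12 (\<xi> - \<eta>) = h12 \<xi> - h12 \<eta>"
  "h13 (\<xi> - \<eta>) = h13 \<xi> - h13 \<eta>" "h23 (\<xi> - \<eta>) = h23 \<xi> - h23 \<eta>"
  by (simp_all add: h_vec_def h_def h12_def h13_def h23_def vec_eq_iff blinfun.bilinear_simps)

subsection \<open>Kernel and image of the skew matrix\<close>

lemma skew_mult:
  "skew p q r *v x = vector [p * x $ 2 + q * x $ 3, r * x $ 3 - p * x $ 1, - q * x $ 1 - r * x $ 2]"
  by (simp add: skew_def matrix_vector_mult_def vec_eq_iff forall_3 sum_3 vector_3)

lemma skew_inner: "x \<bullet> (skew p q r *v y) = - ((skew p q r *v x) \<bullet> y)"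
  by (simp add: skew_mult inner_vec_def sum_3 vector_3 algebra_simps)

lemma skew_eq_0_iff: "skew p q r = 0 \<longleftrightarrow> p = 0 \<and> q = 0 \<and> r = 0"
  by (auto simp: skew_def vec_eq_iff forall_3 vector_3)

text \<open>The matrix acts as the cross product \<open>x \<mapsto> x \<times> n\<close> with
  \<open>n = (r, -q, p)\<close>, so for nonzero \<open>n\<close> it kills exactly the multiples of
  \<open>n\<close>.\<close>

lemma kernel_skew:
  assumes "skew p q r \<noteq> 0"
  shows "kernel (skew p q r) = span {vector [r, - q, p]}"
proof (intro equalityI subsetI)
  fix x assume "x \<in> kernel (skew p q r)"
  then have e: "p * x $ 2 + q * x $ 3 = 0" "r * x $ 3 - p * x $ 1 = 0" "- q * x $ 1 - r * x $ 2 = 0"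
    by (auto simp: kernel_def skew_mult vec_eq_iff forall_3 vector_3)
  \<comment> \<open>The factor \<open>c\<close> is read off from a coordinate in which
    \<open>n\<close> does not vanish.\<close>
  from assms consider "p \<noteq> 0" | "q \<noteq> 0" | "r \<noteq> 0" by (auto simp: skew_eq_0_iff)
  then have "\<exists>c. x = c *\<^sub>R vector [r, - q, p]"
  proof cases
    case 1
    with e show ?thesis
      by (intro exI[of _ "x $ 3 / p"]) (auto simp: vec_eq_iff forall_3 vector_3 field_simps)
  next
    case 2
    with e show ?thesis
      by (intro exI[of _ "- x $ 2 / q"]) (auto simp: vec_eq_iff forall_3 vector_3 field_simps)
  next
    case 3
    with e show ?thesis
      by (intro exI[of _ "x $ 1 / r"]) (auto simp: vec_eq_iff forall_3 vector_3 field_simps)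
  qed
  then show "x \<in> span {vector [r, - q, p]}" by (auto simp: span_singleton)
next
  fix x :: "real^3" assume "x \<in> span {vector [r, - q, p]}"
  then show "x \<in> kernel (skew p q r)"
    by (auto simp: span_singleton kernel_def skew_mult vec_eq_iff forall_3 vector_3)
qed

lemma kernel_skew_generator_nonzero:
  assumes "skew p q r \<noteq> 0" "kernel (skew p q r) = span {a}"
  shows "a \<noteq> 0"
proof
  assume "a = 0"
  moreover have "vector [r, - q, p] \<in> kernel (skew p q r)"
    using kernel_skew[OF assms(1)] by (simp add: span_base)
  ultimately have "(vector [r, - q, p] :: real^3) = 0"
    using assms(2) by simp
  with assms(1) show False
    unfolding skew_eq_0_iff by (simp add: vec_eq_iff forall_3 vector_3)
qed

text \<open>Turns the conservation of all \<open>I a\<close> into solvability of a linear system.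
  For a nonzero matrix the square acts as a nonzero scalar on the complement of the kernel, so a
  multiple of \<open>M v\<close> is a preimage of \<open>v\<close>.\<close>

lemma orthogonal_kernel_skew_iff:
  "(\<forall>a\<in>kernel (skew p q r). a \<bullet> v = 0) \<longleftrightarrow> (\<exists>x. v = skew p q r *v x)"
proof (intro iffI)
  assume orth: "\<forall>a\<in>kernel (skew p q r). a \<bullet> v = 0"
  show "\<exists>x. v = skew p q r *v x"
  proof (cases "skew p q r = 0")
    case True
    \<comment> \<open>The kernel is the whole space here, so \<open>v\<close> is orthogonal to
      itself.\<close>
    with orth have "v \<bullet> v = 0" by (simp add: kernel_def)
    then show ?thesis using True by simp
  next
    case False
    define N where "N = p * p + q * q + r * r"
    have "vector [r, - q, p] \<bullet> v = 0" using orth kernel_skew[OF False] by (simp add: span_base)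
    then have v: "r * v $ 1 - q * v $ 2 + p * v $ 3 = 0"
      by (simp add: inner_vec_def sum_3 vector_3)
    have "N \<noteq> 0" using False
      unfolding N_def skew_eq_0_iff by (smt (verit) mult_eq_0_iff zero_le_square)
    \<comment> \<open>\<open>M\<^sup>2 v = n (n \<bullet> v) - N v\<close> for the kernel vector \<open>n = (r, -q, p)\<close> with \<open>N = |n|\<^sup>2\<close>\<close>
    have "skew p q r *v (skew p q r *v v) = (- N) *\<^sub>R v"
    proof -
      have "skew p q r *v (skew p q r *v v)
          = (r * v $ 1 - q * v $ 2 + p * v $ 3) *\<^sub>R vector [r, - q, p] - N *\<^sub>R v"
        by (simp add: skew_mult vec_eq_iff forall_3 vector_3 N_def algebra_simps)
      with v show ?thesis by simp
    qed
    then have "v = skew p q r *v ((- 1 / N) *\<^sub>R (skew p q r *v v))"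
      using \<open>N \<noteq> 0\<close> by (simp only: matrix_vector_mult_scaleR) simp
    then show ?thesis by blast
  qed
next
  assume "\<exists>x. v = skew p q r *v x"
  then show "\<forall>a\<in>kernel (skew p q r). a \<bullet> v = 0"
    by (auto simp: kernel_def skew_inner)
qed

subsection \<open>Coadjoint orbits\<close>

lemma bounded_linear_lie_bracket: "bounded_linear (lie_bracket g)"
  using lie_bracket_bilinear unfolding bilinear_def linear_conv_bounded_linear by blast

text \<open>In exponential coordinates, conjugation by \<open>g\<close> is already the linear map
  \<open>k \<mapsto> k + [g, k]\<close>, the series of \<open>exp (ad g)\<close> cut off by step 2;
  it is therefore its own derivative.\<close>

lemma Ad_eq: "Ad g y = y + lie_bracket g y"
proof -
  note bl = bilinear_ladd[OF lie_bracket_bilinear] bilinear_radd[OF lie_bracket_bilinear]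
    bilinear_lmul[OF lie_bracket_bilinear] bilinear_rmul[OF lie_bracket_bilinear]
    bilinear_rneg[OF lie_bracket_bilinear]
  have anti: "lie_bracket k g = - lie_bracket g k" for k
    by (simp add: lie_bracket_def Let_def algebra_simps)
  have "(\<lambda>k. group_mult (group_mult g k) (group_inv g)) = (\<lambda>k. k + lie_bracket g k)"
    by (rule ext) (simp add: group_mult_def group_inv_def bl lie_bracket_step_2 lie_bracket_self anti
        flip: scaleR_add_left)
  moreover have "((\<lambda>k. k + lie_bracket g k) has_derivative (\<lambda>k. k + lie_bracket g k)) (at 0)"
    by (intro bounded_linear_imp_has_derivative bounded_linear_add bounded_linear_ident
        bounded_linear_lie_bracket)
  ultimately show ?thesis
    unfolding Ad_def by (simp only: flip: frechet_derivative_at)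
qed

lemma coadjoint_apply: "blinfun_apply (coadjoint g \<xi>) y = blinfun_apply \<xi> y - blinfun_apply \<xi> (lie_bracket g y)"
proof -
  \<comment> \<open>\<open>Blinfun\<close> is guaranteed to return the given function only when that
    function is bounded linear.\<close>
  have "bounded_linear (\<lambda>y. blinfun_apply \<xi> (y - lie_bracket g y))"
    by (intro bounded_linear_compose[OF blinfun.bounded_linear_right] bounded_linear_sub
        bounded_linear_ident bounded_linear_lie_bracket)
  then have "blinfun_apply (Blinfun (\<lambda>y. blinfun_apply \<xi> (y - lie_bracket g y))) y
      = blinfun_apply \<xi> (y - lie_bracket g y)"
    by (simp only: bounded_linear_Blinfun_apply)
  moreover have "Ad (group_inv g) y = y - lie_bracket g y" for y
    by (simp add: Ad_eq group_inv_def bilinear_lneg[OF lie_bracket_bilinear])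
  ultimately show ?thesis
    by (simp add: coadjoint_def blinfun.diff_right)
qed

lemma coadjoint_coordinates:
  "h12 (coadjoint g \<xi>) = h12 \<xi>" "h13 (coadjoint g \<xi>) = h13 \<xi>" "h23 (coadjoint g \<xi>) = h23 \<xi>"
  "h_vec (coadjoint g \<xi>) = h_vec \<xi> + M \<xi> *v fst g"
proof -
  show "h12 (coadjoint g \<xi>) = h12 \<xi>" "h13 (coadjoint g \<xi>) = h13 \<xi>" "h23 (coadjoint g \<xi>) = h23 \<xi>"
    by (simp_all add: h12_def h13_def h23_def coadjoint_apply bracket_pairing
        X12_def X13_def X23_def)
  \<comment> \<open>The sign from skew-symmetry cancels the minus sign in
    \<open>coadjoint_apply\<close>.\<close>
  have "fst g \<bullet> (M \<xi> *v axis i 1) = - (M \<xi> *v fst g) $ i" for i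
    unfolding M_def skew_inner by (simp add: inner_axis)
  then show "h_vec (coadjoint g \<xi>) = h_vec \<xi> + M \<xi> *v fst g"
    by (simp add: vec_eq_iff h_vec_def h_def coadjoint_apply bracket_pairing X_def)
qed

text \<open>Quantifying over the whole kernel covers both cases at once: a line of conditions for
  nonzero \<open>M \<xi>\<close>, and all of \<open>h_vec\<close> when \<open>M \<xi>\<close>
  vanishes.\<close>

lemma coadjoint_orbit_eq:
  "coadjoint_orbit \<xi> = {\<eta>. h12 \<eta> = h12 \<xi> \<and> h13 \<eta> = h13 \<xi> \<and> h23 \<eta> = h23 \<xi> \<and>
     (\<forall>a\<in>kernel (M \<xi>). I a \<eta> = I a \<xi>)}" (is "_ = ?S")
proof (intro equalityI subsetI)
  fix \<eta> assume "\<eta> \<in> coadjoint_orbit \<xi>"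
  then obtain g where "\<eta> = coadjoint g \<xi>" by (auto simp: coadjoint_orbit_def)
  then show "\<eta> \<in> ?S"
    by (auto simp: coadjoint_coordinates I_eq_inner inner_add_right M_def skew_inner kernel_def)
next
  fix \<eta> assume \<eta>: "\<eta> \<in> ?S"
  then have "\<forall>a\<in>kernel (M \<xi>). a \<bullet> (h_vec \<eta> - h_vec \<xi>) = 0"
    by (auto simp: I_eq_inner inner_diff_right)
  then obtain x where "h_vec \<eta> - h_vec \<xi> = M \<xi> *v x"
    unfolding M_def orthogonal_kernel_skew_iff by blast
  then have "\<eta> = coadjoint (x, 0) \<xi>"
    using \<eta> by (intro lie_dual_eqI) (auto simp: coadjoint_coordinates algebra_simps)
  then show "\<eta> \<in> coadjoint_orbit \<xi>" by (auto simp: coadjoint_orbit_def)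
qed

subsection \<open>Symplectic leaves\<close>

lemma Ck_on_const: "Ck_on k U (\<lambda>x. c)"
  by (induction k arbitrary: c) (auto simp: frechet_derivative_const)

lemma smooth_on_affine:
  assumes "bounded_linear f"
  shows "smooth_on U (\<lambda>x. f x + c)"
proof -
  have d: "((\<lambda>x. f x + c) has_derivative f) (at x within A)" for x A
    using bounded_linear_imp_has_derivative[OF assms, of "at x within A"]
    by (auto intro!: derivative_eq_intros)
  have "Ck_on k U (\<lambda>x. f x + c)" for k
  proof (cases k)
    case 0
    then show ?thesis using has_derivative_continuous_on[OF d] by simp
  next
    case (Suc m)
    have "frechet_derivative (\<lambda>x. f x + c) (at x) = f" for x
      using frechet_derivative_at[OF d] by simp
    then show ?thesis using Suc d by (auto simp: Ck_on_const differentiable_def)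
  qed
  then show ?thesis by (simp add: smooth_on_def)
qed

lemma smooth_on_evaluation: "smooth_on U (\<lambda>\<eta>::lie_dual. blinfun_apply \<eta> y)"
  using smooth_on_affine[OF blinfun.bounded_linear_left, of U y 0] by simp

text \<open>Expansion of \<open>\<eta>\<close> in the dual basis
  \<open>blinfun_inner_left b\<close>. This identifies the bidual with \<open>L\<close> and gives
  the existence part for the definite description in \<open>differential\<close>.\<close>

lemma lie_dual_reflexive:
  fixes T :: "lie_dual \<Rightarrow> real"
  assumes "linear T"
  obtains x where "\<And>\<eta>. T \<eta> = blinfun_apply \<eta> x"
proof
  fix \<eta> :: lie_dual
  have "\<eta> = (\<Sum>b\<in>Basis. blinfun_apply \<eta> b *\<^sub>R blinfun_inner_left b)"
  proof (rule blinfun_eqI)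
    fix y
    have "blinfun_apply \<eta> y = blinfun_apply \<eta> (\<Sum>b\<in>Basis. (y \<bullet> b) *\<^sub>R b)"
      by (simp only: euclidean_representation)
    then show "blinfun_apply \<eta> y = blinfun_apply (\<Sum>b\<in>Basis. blinfun_apply \<eta> b *\<^sub>R blinfun_inner_left b) y"
      by (simp add: blinfun.bilinear_simps mult.commute inner_commute)
  qed
  then have "T \<eta> = T (\<Sum>b\<in>Basis. blinfun_apply \<eta> b *\<^sub>R blinfun_inner_left b)" by simp
  then show "T \<eta> = blinfun_apply \<eta> (\<Sum>b\<in>Basis. T (blinfun_inner_left b) *\<^sub>R b)"
    by (simp add: linear_sum[OF assms] linear_cmul[OF assms] blinfun.bilinear_simps mult.commute)
qed

lemma differential_correct:
  assumes "f differentiable (at \<xi>)"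
  shows "frechet_derivative f (at \<xi>) \<eta> = blinfun_apply \<eta> (differential f \<xi>)"
proof -
  obtain x where x: "\<And>\<eta>. frechet_derivative f (at \<xi>) \<eta> = blinfun_apply \<eta> x"
    using lie_dual_reflexive[OF linear_frechet_derivative[OF assms]] by metis
  then have "differential f \<xi> = x"
    unfolding differential_def by (intro the_equality) (auto intro: blinfun_separates)
  with x show ?thesis by simp
qed

text \<open>Vanishing of the bracket is asked only on the level set of the
  \<open>h\<^sub>i\<^sub>j\<close> through \<open>\<xi>\<close>: for \<open>a\<close> in the kernel
  of \<open>M \<xi>\<close>, evaluation at \<open>(a, 0)\<close> need not be a Casimir
  elsewhere.\<close>

lemma hamiltonian_step_casimir:
  assumes "hamiltonian_step \<xi> \<eta>"
    and casimir: "\<And>\<zeta> x. h12 \<zeta> = h12 \<xi> \<Longrightarrow> h13 \<zeta> = h13 \<xi> \<Longrightarrow> h23 \<zeta> = h23 \<xi> \<Longrightarrow>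
      blinfun_apply \<zeta> (lie_bracket x y) = 0"
  shows "blinfun_apply \<eta> y = blinfun_apply \<xi> y"
proof -
  obtain H \<gamma> where \<gamma>: "hamiltonian_curve H \<gamma>" "\<gamma> 0 = \<xi>" "\<gamma> 1 = \<eta>"
    using assms(1) by (auto simp: hamiltonian_step_def)
  have const: "blinfun_apply (\<gamma> t) z = blinfun_apply (\<gamma> 0) z"
    if "t \<in> {0..1}" and
      "\<And>s x. s \<in> {0..1} \<Longrightarrow> blinfun_apply (\<gamma> s) (lie_bracket x z) = 0" for z t
  proof -
    have "((\<lambda>s. blinfun_apply (\<gamma> s) z) has_real_derivative 0) (at s within {0..1})"
      if "s \<in> {0..1}" for s
    proof -
      have "((\<lambda>s. blinfun_apply (\<gamma> s) z) has_real_derivative poisson H (\<lambda>\<eta>. blinfun_apply \<eta> z) (\<gamma> s))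
          (at s within {0..1})"
        using \<gamma>(1) smooth_on_evaluation[of UNIV z] that unfolding hamiltonian_curve_def by blast
      moreover have "poisson H (\<lambda>\<eta>. blinfun_apply \<eta> z) (\<gamma> s) = 0"
        using that \<open>\<And>s x. s \<in> {0..1} \<Longrightarrow> blinfun_apply (\<gamma> s) (lie_bracket x z) = 0\<close>
        by (simp add: poisson_def differential_apply)
      ultimately show ?thesis by simp
    qed
    then have "\<exists>c. \<forall>s\<in>{0..1}. blinfun_apply (\<gamma> s) z = c"
      by (intro has_field_derivative_zero_constant convex_real_interval)
    then show ?thesis using \<open>t \<in> _\<close> by force
  qed
  \<comment> \<open>First use of \<open>const\<close>, for central elements: the trajectory stays in
    the level set on which \<open>casimir\<close> applies, which then permits the second use, for
    \<open>y\<close>.\<close>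
  have "h12 (\<gamma> t) = h12 \<xi>" "h13 (\<gamma> t) = h13 \<xi>" "h23 (\<gamma> t) = h23 \<xi>" if "t \<in> {0..1}" for t
    unfolding h12_def h13_def h23_def \<gamma>(2)[symmetric]
    by (intro const that; simp add: bracket_pairing X12_def X13_def X23_def)+
  then show ?thesis
    using const[of 1 y] casimir \<gamma>(2,3) by auto
qed

lemma hamiltonian_step_in_orbit:
  assumes "hamiltonian_step \<xi> \<eta>"
  shows "\<eta> \<in> coadjoint_orbit \<xi>"
proof -
  have "h12 \<eta> = h12 \<xi>" "h13 \<eta> = h13 \<xi>" "h23 \<eta> = h23 \<xi>"
    unfolding h12_def h13_def h23_def
    by (intro hamiltonian_step_casimir[OF assms];
        simp add: bracket_pairing X12_def X13_def X23_def)+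
  moreover have "I a \<eta> = I a \<xi>" if "a \<in> kernel (M \<xi>)" for a
  proof -
    have "blinfun_apply \<eta> (a, 0) = blinfun_apply \<xi> (a, 0)"
      using that
      by (intro hamiltonian_step_casimir[OF assms]) (auto simp: bracket_pairing M_def kernel_def)
    then show ?thesis by (simp add: blinfun_apply_coords I_eq_inner inner_commute)
  qed
  ultimately show ?thesis by (simp add: coadjoint_orbit_eq)
qed

lemma hamiltonian_step_coadjoint: "hamiltonian_step \<xi> (coadjoint g \<xi>)"
proof -
  define \<mu> where "\<mu> = coadjoint g \<xi> - \<xi>"
  define \<gamma> where "\<gamma> t = \<xi> + t *\<^sub>R \<mu>" for t :: real
  \<comment> \<open>The sign makes the velocity at \<open>\<xi>\<close> equal to
    \<open>y \<mapsto> - \<xi> [g, y]\<close>, which is \<open>\<mu>\<close>.\<close>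
  define H where "H \<eta> = blinfun_apply \<eta> (- g)" for \<eta> :: lie_dual
  have H: "differential H \<zeta> = - g" for \<zeta>
    unfolding H_def[abs_def] by (rule differential_apply)
  have \<mu>: "blinfun_apply \<mu> y = - blinfun_apply \<xi> (lie_bracket g y)" for y
    by (simp add: \<mu>_def blinfun.bilinear_simps coadjoint_apply)
  have "hamiltonian_curve H \<gamma>"
    unfolding hamiltonian_curve_def
  proof (intro allI impI ballI)
    fix f :: "lie_dual \<Rightarrow> real" and t :: real
    assume "smooth_on UNIV f"
    then have "Ck_on (Suc 0) UNIV f" unfolding smooth_on_def by blast
    then have df: "f differentiable (at (\<gamma> t))" by simp
    have "(\<gamma> has_vector_derivative \<mu>) (at t within {0..1})"
      unfolding \<gamma>_def[abs_def] by (auto intro!: derivative_eq_intros)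
    moreover have "(f has_derivative frechet_derivative f (at (\<gamma> t))) (at (\<gamma> t))"
      using df by (simp add: frechet_derivative_works)
    ultimately have "((f \<circ> \<gamma>) has_vector_derivative frechet_derivative f (at (\<gamma> t)) \<mu>) (at t within {0..1})"
      by (intro vector_derivative_diff_chain_within) (auto intro: has_derivative_at_withinI)
    \<comment> \<open>By step 2, \<open>\<mu>\<close> vanishes on brackets \<open>[g, y]\<close>, so
      the Hamiltonian field is constant along the segment and the straight line is its
      trajectory.\<close>
    moreover have "frechet_derivative f (at (\<gamma> t)) \<mu> = poisson H f (\<gamma> t)"
      unfolding differential_correct[OF df] poisson_def H
      by (simp add: \<mu> \<gamma>_def blinfun.bilinear_simps bilinear_lneg[OF lie_bracket_bilinear]
          bilinear_rneg[OF lie_bracket_bilinear] lie_bracket_step_2)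
    ultimately show "((\<lambda>s. f (\<gamma> s)) has_real_derivative poisson H f (\<gamma> t)) (at t within {0..1})"
      by (simp add: has_real_derivative_iff_has_vector_derivative o_def)
  qed
  moreover have "smooth_on UNIV H" unfolding H_def[abs_def] by (rule smooth_on_evaluation)
  moreover have "\<gamma> 0 = \<xi>" "\<gamma> 1 = coadjoint g \<xi>" by (simp_all add: \<gamma>_def \<mu>_def)
  ultimately show ?thesis unfolding hamiltonian_step_def by blast
qed

lemma symplectic_leaf_eq_coadjoint_orbit: "symplectic_leaf \<xi> = coadjoint_orbit \<xi>"
proof (intro equalityI subsetI)
  fix \<eta> assume "\<eta> \<in> symplectic_leaf \<xi>"
  then have "hamiltonian_step\<^sup>*\<^sup>* \<xi> \<eta>" by (simp add: symplectic_leaf_def)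
  then show "\<eta> \<in> coadjoint_orbit \<xi>"
  proof induction
    case base
    show ?case by (simp add: coadjoint_orbit_eq)
  next
    \<comment> \<open>Orbit membership composes because \<open>M\<close> depends only on the
      \<open>h\<^sub>i\<^sub>j\<close>, so both points have the same kernel.\<close>
    case (step \<eta> \<zeta>)
    then show ?case
      using hamiltonian_step_in_orbit[OF step(2)] by (simp add: coadjoint_orbit_eq M_def)
  qed
next
  fix \<eta> assume "\<eta> \<in> coadjoint_orbit \<xi>"
  then show "\<eta> \<in> symplectic_leaf \<xi>"
    using hamiltonian_step_coadjoint by (auto simp: coadjoint_orbit_def symplectic_leaf_def)
qed

subsection \<open>The two families of leaves\<close>

lemma coadjoint_orbit_nonzero:
  assumes "M \<xi> \<noteq> 0" "kernel (M \<xi>) = span {a}"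
  shows "coadjoint_orbit \<xi> = {\<eta>. h12 \<eta> = h12 \<xi> \<and> h13 \<eta> = h13 \<xi> \<and> h23 \<eta> = h23 \<xi> \<and> I a \<eta> = I a \<xi>}"
proof -
  \<comment> \<open>\<open>I\<close> is linear in its index, so a generator of the kernel
    suffices.\<close>
  have "(\<forall>b\<in>span {a}. I b \<eta> = I b \<xi>) \<longleftrightarrow> I a \<eta> = I a \<xi>" for \<eta>
    by (auto simp: span_singleton I_eq_inner intro: rev_image_eqI[of 1])
  then show ?thesis by (simp add: coadjoint_orbit_eq assms)
qed

lemma coadjoint_orbit_zero:
  assumes "M \<xi> = 0"
  shows "coadjoint_orbit \<xi> = {\<xi>}"
proof -
  have "h_vec \<eta> = h_vec \<xi>" if "\<forall>a. I a \<eta> = I a \<xi>" for \<eta>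
    using that by (metis I_eq_inner vector_eq_rdot inner_commute)
  then show ?thesis
    by (auto simp: coadjoint_orbit_eq assms kernel_def intro!: lie_dual_eqI)
qed

lemma leaf_zero_eq_singleton:
  "{\<xi>. h12 \<xi> = 0 \<and> h13 \<xi> = 0 \<and> h23 \<xi> = 0 \<and> h 1 \<xi> = c1 \<and> h 2 \<xi> = c2 \<and> h 3 \<xi> = c3}
    = {of_coords (vector [c1, c2, c3]) 0}"
  by (auto intro!: lie_dual_eqI simp: h_vec_def vec_eq_iff forall_3 vector_3)

lemma range_coadjoint_orbit: "range coadjoint_orbit = leaves_M_nonzero \<union> leaves_M_zero"
proof (intro equalityI subsetI)
  fix S assume "S \<in> range coadjoint_orbit"
  then obtain \<xi> where S: "S = coadjoint_orbit \<xi>" by blast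
  show "S \<in> leaves_M_nonzero \<union> leaves_M_zero"
  proof (cases "M \<xi> = 0")
    case True
    then have "h12 \<xi> = 0" "h13 \<xi> = 0" "h23 \<xi> = 0" by (auto simp: M_def skew_eq_0_iff)
    then have "\<xi> = of_coords (vector [h 1 \<xi>, h 2 \<xi>, h 3 \<xi>]) 0"
      by (intro lie_dual_eqI) (auto simp: h_vec_def vec_eq_iff forall_3 vector_3)
    then have "S \<in> leaves_M_zero"
      unfolding leaves_M_zero_def leaf_zero_eq_singleton S coadjoint_orbit_zero[OF True] by blast
    then show ?thesis ..
  next
    case False
    then show ?thesis
      using coadjoint_orbit_nonzero[OF False] kernel_skew False
      unfolding S M_def leaves_M_nonzero_def by blast
  qed
next
  fix S assume "S \<in> leaves_M_nonzero \<union> leaves_M_zero"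
  then show "S \<in> range coadjoint_orbit"
  proof
    assume "S \<in> leaves_M_nonzero"
    then obtain p q r c a where nz: "skew p q r \<noteq> 0" and ker: "kernel (skew p q r) = span {a}"
      and S: "S = {\<xi>. h12 \<xi> = p \<and> h13 \<xi> = q \<and> h23 \<xi> = r \<and> I a \<xi> = c}"
      unfolding leaves_M_nonzero_def by blast
    have "a \<noteq> 0" by (rule kernel_skew_generator_nonzero[OF nz ker])
    \<comment> \<open>The point of the level plane \<open>a \<bullet> v = c\<close> nearest to the
      origin; it shows that every member of the family is nonempty.\<close>
    define \<xi> where "\<xi> = of_coords ((c / (a \<bullet> a)) *\<^sub>R a) (vector [p, q, r])"
    have \<xi>: "h12 \<xi> = p" "h13 \<xi> = q" "h23 \<xi> = r" "I a \<xi> = c"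
      using \<open>a \<noteq> 0\<close> by (simp_all add: \<xi>_def vector_3 I_eq_inner)
    then have "S = coadjoint_orbit \<xi>"
      using coadjoint_orbit_nonzero[of \<xi> a] nz ker by (simp add: M_def S)
    then show ?thesis by blast
  next
    assume "S \<in> leaves_M_zero"
    then obtain c1 c2 c3 where "S = {of_coords (vector [c1, c2, c3]) 0}"
      unfolding leaves_M_zero_def leaf_zero_eq_singleton by blast
    then have "S = coadjoint_orbit (of_coords (vector [c1, c2, c3]) 0)"
      by (subst coadjoint_orbit_zero) (auto simp: M_def skew_eq_0_iff)
    then show ?thesis by blast
  qed
qed

section \<open>Dimensions and smoothness of the leaves\<close>

lemma smooth_submanifold_affine:
  fixes S W :: "'a::real_normed_vector set"
  assumes "subspace W" "dim W = d" "\<And>p x. p \<in> S \<Longrightarrow> x \<in> S \<longleftrightarrow> x - p \<in> W"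
  shows "smooth_submanifold d S"
  unfolding smooth_submanifold_def
proof
  fix p assume p: "p \<in> S"
  \<comment> \<open>\<open>S\<close> is the coset \<open>p + W\<close>, so translation by
    \<open>- p\<close> is a global straightening.\<close>
  have "(\<lambda>x. x - p) ` S = W"
    using assms(3)[OF p] by (force intro: rev_image_eqI[of "_ + p"])
  moreover have "smooth_on UNIV (\<lambda>x. x - p)" "smooth_on UNIV (\<lambda>x. x + p)"
    using smooth_on_affine[OF bounded_linear_ident, of UNIV "- p"]
      smooth_on_affine[OF bounded_linear_ident, of UNIV p] by auto
  moreover have "range (\<lambda>x. x - p) = UNIV" "range (\<lambda>x. x + p) = UNIV"
    by (auto intro: rev_image_eqI[of "_ + p"] rev_image_eqI[of "_ - p"])
  ultimately show "\<exists>U V W. \<exists>\<phi> \<psi> :: 'a \<Rightarrow> 'a.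
       open U \<and> p \<in> U \<and> open V \<and> smooth_on U \<phi> \<and> smooth_on V \<psi> \<and>
       \<phi> ` U = V \<and> \<psi> ` V = U \<and> (\<forall>x\<in>U. \<psi> (\<phi> x) = x) \<and> (\<forall>y\<in>V. \<phi> (\<psi> y) = y) \<and>
       subspace W \<and> dim W = d \<and> \<phi> ` (U \<inter> S) = V \<inter> W"
    using assms(1,2)
    by - (rule exI[of _ UNIV], rule exI[of _ UNIV], rule exI[of _ W],
        rule exI[of _ "\<lambda>x. x - p"], rule exI[of _ "\<lambda>x. x + p"], simp)
qed

lemma smooth_submanifold_leaf_zero:
  assumes "S \<in> leaves_M_zero"
  shows "smooth_submanifold 0 S"
proof -
  obtain c1 c2 c3 where "S = {of_coords (vector [c1, c2, c3]) 0}"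
    using assms unfolding leaves_M_zero_def leaf_zero_eq_singleton by blast
  moreover have "dim {0 :: lie_dual} = 0"
    using real_vector.dim_span[of "{} :: lie_dual set"]
      real_vector.dim_eq_card_independent[of "{} :: lie_dual set"]
    by (simp add: real_vector.independent_empty)
  ultimately show ?thesis
    by (intro smooth_submanifold_affine[of "{0}"]) auto
qed

lemma smooth_submanifold_leaf_nonzero:
  assumes "S \<in> leaves_M_nonzero"
  shows "smooth_submanifold 2 S"
proof -
  obtain p q r c a where nz: "skew p q r \<noteq> 0" and ker: "kernel (skew p q r) = span {a}"
    and S: "S = {\<xi>. h12 \<xi> = p \<and> h13 \<xi> = q \<and> h23 \<xi> = r \<and> I a \<xi> = c}"
    using assms unfolding leaves_M_nonzero_def by blast
  have "a \<noteq> 0" by (rule kernel_skew_generator_nonzero[OF nz ker])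
  define E where "E v = of_coords v 0" for v
  define P where "P = {v. a \<bullet> v = 0}"
  have E: "linear E" "inj E"
    unfolding E_def[abs_def] by (rule linear_of_coords, metis injI of_coords_coordinates(1))
  obtain B where B: "B \<subseteq> P" "independent B" "P \<subseteq> span B" "card B = dim P"
    using basis_exists by blast
  have "subspace P" unfolding P_def by (rule subspace_hyperplane)
  then have "span B = P" using B by (simp add: span_minimal subset_antisym)
  then have span: "span (E ` B) = E ` P" by (simp add: linear_span_image[OF E(1)])
  have "dim P = 2" unfolding P_def using dim_hyperplane[OF \<open>a \<noteq> 0\<close>] by simp
  then have "card (E ` B) = 2" using B(4) E(2) by (simp add: card_image inj_on_subset)
  moreover have "independent (E ` B)"
    using linear_independent_injective_image[OF E(1) B(2)] E(2) by (simp add: inj_on_subset)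
  ultimately have "dim (E ` P) = 2"
    unfolding span[symmetric] by (simp add: real_vector.dim_eq_card_independent)
  moreover have "E ` P = {\<xi>. h12 \<xi> = 0 \<and> h13 \<xi> = 0 \<and> h23 \<xi> = 0 \<and> I a \<xi> = 0}"
  proof (intro equalityI subsetI)
    fix \<xi> assume "\<xi> \<in> {\<xi>. h12 \<xi> = 0 \<and> h13 \<xi> = 0 \<and> h23 \<xi> = 0 \<and> I a \<xi> = 0}"
    then have "\<xi> = E (h_vec \<xi>)" "h_vec \<xi> \<in> P"
      by (auto intro!: lie_dual_eqI simp: E_def P_def I_eq_inner)
    then show "\<xi> \<in> E ` P" by blast
  qed (auto simp: E_def P_def I_eq_inner)
  moreover have "subspace (E ` P)" unfolding span[symmetric] by (rule subspace_span)
  ultimately show ?thesis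
    by (intro smooth_submanifold_affine[of "E ` P"])
      (auto simp: S coords_diff I_eq_inner inner_diff_right)
qed

theorem theorem1:
  shows "symplectic_foliation = range coadjoint_orbit
    \<and> symplectic_foliation = leaves_M_nonzero \<union> leaves_M_zero
    \<and> (\<forall>S\<in>leaves_M_nonzero. smooth_submanifold 2 S)
    \<and> (\<forall>S\<in>leaves_M_zero. smooth_submanifold 0 S)"
  by (simp add: symplectic_foliation_def symplectic_leaf_eq_coadjoint_orbit[abs_def]
      range_coadjoint_orbit smooth_submanifold_leaf_nonzero smooth_submanifold_leaf_zero)

end
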